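(* Let $(X,d)$ be a Hadamard space and let $m$ be a positive integer. Suppose that $S_i : X \to X$ is a strongly quasi-nonexpansive $\Delta$-demiclosed mapping for each $i \in \{1,2,\dots,m\}$ and $\bigcap_{i=1}^m Fix(S_i) \neq \emptyset$. If $S = S_m S_{m-1}\cdots S_1$ and $x_n := S^n(p_0)$ for each $n \in \mathbb{N}$, where $p_0 \in X$, then the sequence $\{x_n\}$ is $\Delta$-convergent to an element $p^\ast \in \bigcap_{i=1}^m Fix(S_i)$.
   Context: A Hadamard space is a complete $\mathrm{CAT}(0)$ space. Products of mappings denote composition: $S_m S_{m-1}\cdots S_1 = S_m\circ S_{m-1}\circ\cdots\circ S_1$, and $S^n$ is the $n$-th iterate of $S$. For a bounded sequence $\{x_n\}$ in $X$, the asymptotic center is $\mathcal{A}(\{x_n\}) = \{ z \in X : \limsup_{n} d(z,x_n) = \inf_{y \in X} \limsup_{n} d(y,x_n)\}$ (a singleton in a Hadamard space). A bounded sequence $\{x_n\}$ is $\Delta$-convergent to $z \in X$ ($z$ is the $\Delta$-limit) if $\mathcal{A}(\{x_{n_i}\}) = \{z\}$ for each subsequence $\{x_{n_i}\}$ of $\{x_n\}$. For $S : X \to X$, $Fix(S) = \{x \in X : S(x) = x\}$. $S$ is quasi-nonexpansive if $Fix(S) \neq \emptyset$ and $d(S(x),q) \le d(x,q)$ for all $x \in X$ and $q \in Fix(S)$. $S$ is strongly quasi-nonexpansive if $S$ is quasi-nonexpansive and $\lim_{n\to\infty} d(x_n, S(x_n)) = 0$ whenever $\{x_n\}$ is a bounded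 sequence in $X$ such that $\lim_{n\to\infty}[d(x_n,q) - d(S(x_n),q)] = 0$ for some $q \in Fix(S)$. $S$ is $\Delta$-demiclosed if for any $\Delta$-convergent sequence $\{x_n\}$ in $X$, its $\Delta$-limit belongs to $Fix(S)$ whenever $\lim_{n\to\infty} d(x_n,S(x_n)) = 0$. *)

theory Defs
  imports "HOL-Analysis.Analysis"
begin

section \<open>Hadamard spaces\<close>

text \<open>Geodesics are parametrised by arc length, so the endpoint sits at parameter \<open>dist x y\<close>.\<close>

definition geodesic_path :: "(real \<Rightarrow> 'a::metric_space) \<Rightarrow> 'a \<Rightarrow> 'a \<Rightarrow> bool" where
  "geodesic_path c x y \<longleftrightarrow> c 0 = x \<and> c (dist x y) = y \<and>
     (\<forall>s\<in>{0..dist x y}. \<forall>t\<in>{0..dist x y}. dist (c s) (c t) = \<bar>s - t\<bar>)"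

definition geodesic_segment :: "'a::metric_space set \<Rightarrow> 'a \<Rightarrow> 'a \<Rightarrow> bool" where
  "geodesic_segment G x y \<longleftrightarrow> (\<exists>c. geodesic_path c x y \<and> G = c ` {0..dist x y})"

text \<open>Geodesics need not be unique in a general geodesic space, so a triangle consists of its
  vertices together with a choice of its three sides.\<close>

definition geodesic_triangle ::
  "'a::metric_space \<Rightarrow> 'a \<Rightarrow> 'a \<Rightarrow> 'a set \<Rightarrow> 'a set \<Rightarrow> 'a set \<Rightarrow> bool" where
  "geodesic_triangle p q r Gpq Gqr Grp \<longleftrightarrow>
     geodesic_segment Gpq p q \<and> geodesic_segment Gqr q r \<and> geodesic_segment Grp r p"

definition comparison_triangle ::
  "'a::metric_space \<Rightarrow> 'a \<Rightarrow> 'a \<Rightarrow> real^2 \<Rightarrow> real^2 \<Rightarrow> real^2 \<Rightarrow> bool" where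
  "comparison_triangle p q r p' q' r' \<longleftrightarrow>
     dist p' q' = dist p q \<and> dist q' r' = dist q r \<and> dist r' p' = dist r p"

definition comparison_point_on ::
  "'a::metric_space set \<Rightarrow> 'a \<Rightarrow> real^2 \<Rightarrow> real^2 \<Rightarrow> 'a \<Rightarrow> real^2 \<Rightarrow> bool" where
  "comparison_point_on G a a' b' x x' \<longleftrightarrow>
     x \<in> G \<and> x' \<in> closed_segment a' b' \<and> dist a' x' = dist a x"

definition comparison_point ::
  "'a::metric_space \<Rightarrow> 'a \<Rightarrow> 'a \<Rightarrow> 'a set \<Rightarrow> 'a set \<Rightarrow> 'a set \<Rightarrow> real^2 \<Rightarrow> real^2 \<Rightarrow> real^2 \<Rightarrow>
   'a \<Rightarrow> real^2 \<Rightarrow> bool" where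
  "comparison_point p q r Gpq Gqr Grp p' q' r' x x' \<longleftrightarrow>
     comparison_point_on Gpq p p' q' x x' \<or>
     comparison_point_on Gqr q q' r' x x' \<or>
     comparison_point_on Grp r r' p' x x'"

text \<open>A comparison triangle in the Euclidean plane always exists and is unique up to isometry, so
  quantifying over all of them is the same as fixing one.\<close>

class cat0_space = metric_space +
  assumes geodesic: "\<exists>c. geodesic_path c x y"
    and cat0_inequality:
      "\<lbrakk>geodesic_triangle p q r Gpq Gqr Grp;
        comparison_triangle p q r p' q' r';
        comparison_point p q r Gpq Gqr Grp p' q' r' x x';
        comparison_point p q r Gpq Gqr Grp p' q' r' y y'\<rbrakk>
       \<Longrightarrow> dist x y \<le> dist x' y'"

class hadamard_space = cat0_space + complete_space

section \<open>\<open>\<Delta>\<close>-convergence\<close>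

text \<open>The limit superior is taken in the extended reals, where it always exists; for bounded
  sequences it is finite and agrees with the real one.\<close>

definition asymptotic_center :: "(nat \<Rightarrow> 'a::metric_space) \<Rightarrow> 'a set" where
  "asymptotic_center x =
     {z. limsup (\<lambda>n. ereal (dist z (x n))) = (INF y. limsup (\<lambda>n. ereal (dist y (x n))))}"

definition Delta_convergent_to :: "(nat \<Rightarrow> 'a::metric_space) \<Rightarrow> 'a \<Rightarrow> bool" where
  "Delta_convergent_to x z \<longleftrightarrow>
     bounded (range x) \<and> (\<forall>r. strict_mono r \<longrightarrow> asymptotic_center (x \<circ> r) = {z})"

section \<open>Classes of mappings\<close>

definition Fix :: "('a \<Rightarrow> 'a) \<Rightarrow> 'a set" where
  "Fix S = {x. S x = x}"

definition quasi_nonexpansive :: "('a::metric_space \<Rightarrow> 'a) \<Rightarrow> bool" where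
  "quasi_nonexpansive S \<longleftrightarrow> Fix S \<noteq> {} \<and> (\<forall>x. \<forall>q\<in>Fix S. dist (S x) q \<le> dist x q)"

definition strongly_quasi_nonexpansive :: "('a::metric_space \<Rightarrow> 'a) \<Rightarrow> bool" where
  "strongly_quasi_nonexpansive S \<longleftrightarrow> quasi_nonexpansive S \<and>
     (\<forall>x. bounded (range x) \<longrightarrow>
        (\<exists>q\<in>Fix S. (\<lambda>n. dist (x n) q - dist (S (x n)) q) \<longlonglongrightarrow> 0) \<longrightarrow>
        (\<lambda>n. dist (x n) (S (x n))) \<longlonglongrightarrow> 0)"

definition Delta_demiclosed :: "('a::metric_space \<Rightarrow> 'a) \<Rightarrow> bool" where
  "Delta_demiclosed S \<longleftrightarrow>
     (\<forall>x z. Delta_convergent_to x z \<longrightarrow> (\<lambda>n. dist (x n) (S (x n))) \<longlonglongrightarrow> 0 \<longrightarrow> z \<in> Fix S)"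

primrec composition :: "(nat \<Rightarrow> 'a \<Rightarrow> 'a) \<Rightarrow> nat \<Rightarrow> 'a \<Rightarrow> 'a" where
  "composition S 0 = id"
| "composition S (Suc m) = S (Suc m) \<circ> composition S m"

end

theory Submission
  imports Defs "HOL-Library.Diagonal_Subsequence"
begin

text \<open>Let \<open>F\<close> be the set of common fixed points. Feeding \<open>x n\<close> through the maps one after the other
  gives the intermediate points \<open>y 0 n = x n\<close>, ..., \<open>y m n = x (Suc n)\<close>, and each map can only
  decrease the distance to a point \<open>q\<close> of \<open>F\<close>. So \<open>dist (x n) q\<close> is nonincreasing, hence
  convergent, and the distances of all the \<open>y j n\<close> to \<open>q\<close> are squeezed to the same limit. Each
  single map therefore asymptotically fails to decrease the distance to \<open>q\<close>, and strong
  quasi-nonexpansiveness turns this into \<open>dist (y j n) (y (Suc j) n) \<longlonglongrightarrow> 0\<close>. All the \<open>y j\<close> are thus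
  asymptotically equal to \<open>x\<close> and share the \<open>\<Delta>\<close>-limits of its subsequences
  (\<open>Delta_convergent_perturb\<close>), so demiclosedness of each map puts every such \<open>\<Delta>\<close>-limit into \<open>F\<close>.

  What remains is an Opial-type principle (\<open>Opial_Delta_convergent\<close>): if the distance to every
  point of \<open>F\<close> converges and all \<open>\<Delta>\<close>-limits of subsequences lie in \<open>F\<close>, then the whole sequence
  \<open>\<Delta>\<close>-converges to a point of \<open>F\<close>. The reason is that each \<open>\<Delta>\<close>-limit of a subsequence minimises,
  over \<open>F\<close>, the limiting distance to \<open>x\<close>, and the asymptotic center of a subsequence holds only
  one minimiser. Two facts about Hadamard spaces enter: asymptotic centers of bounded
  sequences are singletons, which follows from the Bruhat-Tits inequality (\<open>CN_inequality\<close>) and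
  completeness, and bounded sequences have \<open>\<Delta>\<close>-convergent subsequences
  (\<open>Delta_convergent_subsequence\<close>), which follows by a diagonal argument.\<close>

section \<open>The Bruhat-Tits inequality\<close>

text \<open>The comparison inequality of a \<open>CAT(0)\<close> space says something only once a comparison triangle
  is at hand. The first side is laid on the horizontal axis; the law of cosines gives the foot
  \<open>u\<close> of the altitude from the third vertex, and the triangle inequalities make its height
  real. The vertices \<open>p\<close> and \<open>q\<close> have to differ because \<open>u\<close> is obtained by dividing by their
  distance.\<close>

lemma comparison_triangle_exists:
  fixes p q r :: "'a::metric_space"
  assumes "p \<noteq> q"
  shows "\<exists>p' q' r'. comparison_triangle p q r p' q' r'"
proof -
  define a b c where "a = dist p q" and "b = dist q r" and "c = dist r p"
  define u where "u = (a\<^sup>2 + c\<^sup>2 - b\<^sup>2) / (2 * a)"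
  have a: "a > 0" and b: "b \<ge> 0" and c: "c \<ge> 0"
    using assms by (auto simp: a_def b_def c_def)
  have tri: "a \<le> b + c" "b \<le> a + c" "c \<le> a + b"
    unfolding a_def b_def c_def
    by (metis dist_commute dist_triangle2 add.commute)+
  have sq: "b\<^sup>2 \<le> (a + c)\<^sup>2" "(a - c)\<^sup>2 \<le> b\<^sup>2"
    using tri a b c by (auto intro!: power_mono abs_le_square_iff[THEN iffD1])
  have ua: "2 * a * u = a\<^sup>2 + c\<^sup>2 - b\<^sup>2"
    using a by (simp add: u_def)
  have "2 * a * \<bar>u\<bar> = \<bar>2 * a * u\<bar>"
    using a by (simp add: abs_mult)
  also have "\<dots> \<le> 2 * a * c"
    unfolding ua using sq by (simp add: power2_sum power2_diff abs_le_iff)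
  finally have "\<bar>u\<bar> \<le> c"
    using a by simp
  then have uc: "u\<^sup>2 \<le> c\<^sup>2"
    using c abs_le_square_iff[of u c] by simp
  define v where "v = sqrt (c\<^sup>2 - u\<^sup>2)"
  have v: "v\<^sup>2 = c\<^sup>2 - u\<^sup>2"
    using uc by (simp add: v_def)
  have bb: "(a - u)\<^sup>2 + v\<^sup>2 = b\<^sup>2"
    using ua v by (simp add: power2_diff algebra_simps)
  have dv: "dist (vector [s, t]) (vector [s', t'] :: real^2) = sqrt ((s - s')\<^sup>2 + (t - t')\<^sup>2)"
    for s t s' t' :: real
    by (simp add: dist_vec_def L2_set_def sum_2 dist_real_def)
  have "comparison_triangle p q r (vector [0, 0]) (vector [a, 0]) (vector [u, v])"
    unfolding comparison_triangle_def dv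
    using a b c bb v by (simp flip: a_def b_def c_def)
  then show ?thesis by blast
qed

text \<open>In the Euclidean plane the right-hand side is, by the parallelogram law, exactly the squared
  distance from \<open>w\<close> to the midpoint of \<open>y\<close> and \<open>z\<close>. Comparing a geodesic midpoint \<open>m\<close> with its
  Euclidean counterpart gives the inequality. The midpoint is chosen before \<open>w\<close>, so
  that one \<open>m\<close> can be tested against all terms of a sequence.\<close>

lemma CN_inequality:
  fixes y z :: "'a::cat0_space"
  shows "\<exists>m. \<forall>w. (dist m w)\<^sup>2 \<le> ((dist y w)\<^sup>2 + (dist z w)\<^sup>2) / 2 - (dist y z)\<^sup>2 / 4"
proof (cases "y = z")
  case True
  then show ?thesis by (intro exI[of _ y]) simp
next
  case False
  obtain c where c: "geodesic_path c y z"
    using geodesic by blast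
  let ?d = "dist y z" and ?m = "c (dist y z / 2)"
  let ?G = "c ` {0..?d}"
  have ym: "dist y ?m = ?d / 2"
  proof -
    have "dist (c 0) ?m = \<bar>0 - ?d / 2\<bar>"
      using c unfolding geodesic_path_def by (elim conjE ballE[of _ _ 0] ballE[of _ _ "?d / 2"]) auto
    then show ?thesis using c by (simp add: geodesic_path_def)
  qed
  have "(dist ?m w)\<^sup>2 \<le> ((dist y w)\<^sup>2 + (dist z w)\<^sup>2) / 2 - (dist y z)\<^sup>2 / 4" for w
  proof -
    obtain G2 G3 where G: "geodesic_segment G2 z w" "geodesic_segment G3 w y"
      using geodesic unfolding geodesic_segment_def by blast
    then have tri: "geodesic_triangle y z w ?G G2 G3"
      using c unfolding geodesic_triangle_def geodesic_segment_def by blast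
    obtain y' z' w' where comp: "comparison_triangle y z w y' z' w'"
      using comparison_triangle_exists[OF False] by blast
    then have d: "dist y' z' = dist y z" "dist z' w' = dist z w" "dist w' y' = dist w y"
      by (auto simp: comparison_triangle_def)
    have "w \<in> G3"
      using G(2) by (auto simp: geodesic_segment_def geodesic_path_def intro!: image_eqI[of _ _ 0])
    then have cw: "comparison_point y z w ?G G2 G3 y' z' w' w w'"
      by (simp add: comparison_point_def comparison_point_on_def)
    have "comparison_point_on ?G y y' z' ?m (midpoint y' z')"
      unfolding comparison_point_on_def using ym d by (auto simp: dist_midpoint)
    then have cm: "comparison_point y z w ?G G2 G3 y' z' w' ?m (midpoint y' z')"
      by (simp add: comparison_point_def)
    have "dist ?m w \<le> dist (midpoint y' z') w'"
      using cat0_inequality[OF tri comp cm cw] .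
    then have "(dist ?m w)\<^sup>2 \<le> (dist (midpoint y' z') w')\<^sup>2"
      by (simp add: power_mono)
    also have "\<dots> = ((dist y' w')\<^sup>2 + (dist z' w')\<^sup>2) / 2 - (dist y' z')\<^sup>2 / 4"
      by (simp add: dist_norm power2_norm_eq_inner midpoint_def field_simps
          inner_simps inner_commute)
    finally show ?thesis
      using d by (simp add: dist_commute)
  qed
  then show ?thesis by blast
qed

section \<open>Asymptotic centers are singletons\<close>

definition asymptotic_distance :: "(nat \<Rightarrow> 'a::metric_space) \<Rightarrow> 'a \<Rightarrow> ereal" where
  "asymptotic_distance x z = limsup (\<lambda>n. ereal (dist z (x n)))"

definition asymptotic_radius :: "(nat \<Rightarrow> 'a::metric_space) \<Rightarrow> ereal" where
  "asymptotic_radius x = (INF z. asymptotic_distance x z)"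

lemma mem_asymptotic_center_iff:
  "z \<in> asymptotic_center x \<longleftrightarrow> asymptotic_distance x z = asymptotic_radius x"
  by (simp add: asymptotic_center_def asymptotic_distance_def asymptotic_radius_def)

lemma asymptotic_radius_le: "asymptotic_radius x \<le> asymptotic_distance x z"
  unfolding asymptotic_radius_def by (rule INF_lower) simp

lemma asymptotic_distance_lessD:
  "asymptotic_distance x z < ereal a \<Longrightarrow> \<forall>\<^sub>F n in sequentially. dist z (x n) < a"
  unfolding asymptotic_distance_def by (drule Limsup_lessD) simp

lemma asymptotic_distance_nonneg: "0 \<le> asymptotic_distance x z"
  unfolding asymptotic_distance_def by (rule le_Limsup) auto

lemma asymptotic_radius_nonneg: "0 \<le> asymptotic_radius x"
  unfolding asymptotic_radius_def by (rule INF_greatest) (rule asymptotic_distance_nonneg)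

lemma asymptotic_radius_real:
  assumes "bounded (range x)"
  obtains R where "asymptotic_radius x = ereal R" "R \<ge> 0"
proof -
  fix z
  obtain C where "\<And>n. dist z (x n) \<le> C"
    using assms by (auto simp: bounded_any_center[of _ z])
  then have "asymptotic_distance x z \<le> ereal C"
    by (simp add: asymptotic_distance_def Limsup_bounded)
  then have "asymptotic_radius x \<le> ereal C"
    using asymptotic_radius_le order_trans by blast
  then show ?thesis
    using that asymptotic_radius_nonneg[of x] by (cases "asymptotic_radius x") auto
qed

text \<open>Two points that are both nearly optimal centers must be close to each other: by the
  Bruhat-Tits inequality their midpoint would otherwise have an asymptotic distance below the
  radius. This single estimate yields the uniqueness of the center and also the Cauchy
  property of minimising sequences.\<close>

lemma asymptotic_distance_near:
  fixes x :: "nat \<Rightarrow> 'a::cat0_space"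
  assumes R: "asymptotic_radius x = ereal R" "R \<ge> 0"
    and y: "asymptotic_distance x y < ereal a" and z: "asymptotic_distance x z < ereal a"
  shows "(dist y z)\<^sup>2 \<le> 4 * (a\<^sup>2 - R\<^sup>2)"
proof -
  obtain m where m: "\<And>w. (dist m w)\<^sup>2 \<le> ((dist y w)\<^sup>2 + (dist z w)\<^sup>2) / 2 - (dist y z)\<^sup>2 / 4"
    using CN_inequality by blast
  define c where "c = a\<^sup>2 - (dist y z)\<^sup>2 / 4"
  have ev: "\<forall>\<^sub>F n in sequentially. (dist m (x n))\<^sup>2 \<le> c"
    using asymptotic_distance_lessD[OF y] asymptotic_distance_lessD[OF z]
  proof eventually_elim
    case (elim n)
    then have "(dist y (x n))\<^sup>2 \<le> a\<^sup>2" "(dist z (x n))\<^sup>2 \<le> a\<^sup>2"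
      by (auto intro!: power_mono)
    then have "((dist y (x n))\<^sup>2 + (dist z (x n))\<^sup>2) / 2 \<le> a\<^sup>2"
      by (simp add: field_simps)
    then show ?case using m[of "x n"] unfolding c_def by linarith
  qed
  then obtain n where "(dist m (x n))\<^sup>2 \<le> c"
    by (auto simp: eventually_sequentially)
  then have c: "c \<ge> 0"
    using zero_le_power2 order_trans by blast
  have "asymptotic_distance x m \<le> ereal (sqrt c)"
    unfolding asymptotic_distance_def
    using ev by (intro Limsup_bounded) (auto elim!: eventually_mono intro: real_le_rsqrt)
  then have "R \<le> sqrt c"
    using asymptotic_radius_le[of x m] R(1) by (metis ereal_less_eq(3) order_trans)
  then have "R\<^sup>2 \<le> c"
    using R(2) c by (metis power_mono real_sqrt_pow2)
  then show ?thesis by (simp add: c_def)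
qed

lemma asymptotic_center_unique:
  fixes x :: "nat \<Rightarrow> 'a::cat0_space"
  assumes "bounded (range x)" and y: "y \<in> asymptotic_center x" and z: "z \<in> asymptotic_center x"
  shows "y = z"
proof -
  obtain R where R: "asymptotic_radius x = ereal R" "R \<ge> 0"
    using asymptotic_radius_real assms by blast
  have "(dist y z)\<^sup>2 \<le> 4 * ((R + inverse (real (Suc n)))\<^sup>2 - R\<^sup>2)" for n
    using y z R by (intro asymptotic_distance_near[OF R]) (auto simp: mem_asymptotic_center_iff)
  moreover have "(\<lambda>n. 4 * ((R + inverse (real (Suc n)))\<^sup>2 - R\<^sup>2)) \<longlonglongrightarrow> 4 * ((R + 0)\<^sup>2 - R\<^sup>2)"
    by (intro tendsto_intros LIMSEQ_inverse_real_of_nat)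
  ultimately have "(dist y z)\<^sup>2 \<le> 4 * ((R + 0)\<^sup>2 - R\<^sup>2)"
    by (intro LIMSEQ_le_const) auto
  then show ?thesis by simp
qed

lemma asymptotic_distance_triangle:
  "asymptotic_distance x z \<le> ereal (dist z y) + asymptotic_distance x y"
proof -
  have "asymptotic_distance x z \<le> limsup (\<lambda>n. ereal (dist z y) + ereal (dist y (x n)))"
    unfolding asymptotic_distance_def by (intro Limsup_mono always_eventually) (auto intro: dist_triangle)
  also have "\<dots> = ereal (dist z y) + asymptotic_distance x y"
    unfolding asymptotic_distance_def by (intro Limsup_add_ereal_left) auto
  finally show ?thesis .
qed

text \<open>Points whose asymptotic distance approaches the radius form a Cauchy sequence, and its limit
  attains the infimum because the asymptotic distance is \<open>1\<close>-Lipschitz.\<close>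

lemma asymptotic_center_nonempty:
  fixes x :: "nat \<Rightarrow> 'a::hadamard_space"
  assumes "bounded (range x)"
  shows "asymptotic_center x \<noteq> {}"
proof -
  obtain R where R: "asymptotic_radius x = ereal R" "R \<ge> 0"
    using asymptotic_radius_real assms by blast
  let ?e = "\<lambda>n. inverse (real (Suc n))"
  have "\<exists>y. asymptotic_distance x y < ereal (R + ?e n)" for n
  proof -
    have "asymptotic_radius x < ereal (R + ?e n)"
      using R(1) by simp
    then show ?thesis
      unfolding asymptotic_radius_def by (simp add: INF_less_iff)
  qed
  then obtain y where y: "\<And>n. asymptotic_distance x (y n) < ereal (R + ?e n)"
    by metis
  have near: "(dist (y k) (y l))\<^sup>2 \<le> 4 * ((R + ?e n)\<^sup>2 - R\<^sup>2)" if "k \<ge> n" "l \<ge> n" for k l n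
  proof -
    have "ereal (R + ?e i) \<le> ereal (R + ?e n)" if "i \<ge> n" for i
      using that by (simp add: le_imp_inverse_le)
    then show ?thesis
      using y that by (intro asymptotic_distance_near[OF R]) (meson less_le_trans)+
  qed
  have "Cauchy y"
  proof (rule metric_CauchyI)
    fix d :: real assume d: "d > 0"
    have "(\<lambda>n. 4 * ((R + ?e n)\<^sup>2 - R\<^sup>2)) \<longlonglongrightarrow> 4 * ((R + 0)\<^sup>2 - R\<^sup>2)"
      by (intro tendsto_intros LIMSEQ_inverse_real_of_nat)
    then have "\<forall>\<^sub>F n in sequentially. 4 * ((R + ?e n)\<^sup>2 - R\<^sup>2) < d\<^sup>2"
      using d by (intro order_tendstoD(2)) auto
    then obtain N where "4 * ((R + ?e N)\<^sup>2 - R\<^sup>2) < d\<^sup>2"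
      by (auto simp: eventually_sequentially)
    then have "\<forall>k\<ge>N. \<forall>l\<ge>N. (dist (y k) (y l))\<^sup>2 < d\<^sup>2"
      using near by (meson le_less_trans)
    then show "\<exists>N. \<forall>k\<ge>N. \<forall>l\<ge>N. dist (y k) (y l) < d"
      using d by (meson less_imp_le power2_less_imp_less)
  qed
  then obtain z where z: "y \<longlonglongrightarrow> z"
    using Cauchy_convergent convergent_def by blast
  have "asymptotic_distance x z \<le> ereal (dist z (y n) + (R + ?e n))" for n
  proof -
    have "asymptotic_distance x z \<le> ereal (dist z (y n)) + asymptotic_distance x (y n)"
      by (rule asymptotic_distance_triangle)
    also have "\<dots> \<le> ereal (dist z (y n)) + ereal (R + ?e n)"
      using y by (intro add_left_mono less_imp_le)
    finally show ?thesis by simp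
  qed
  moreover have "(\<lambda>n. ereal (dist z (y n) + (R + ?e n))) \<longlonglongrightarrow> ereal (dist z z + (R + 0))"
    by (intro tendsto_intros LIMSEQ_inverse_real_of_nat z tendsto_ereal)
  ultimately have "asymptotic_distance x z \<le> ereal (dist z z + (R + 0))"
    by (intro LIMSEQ_le_const) (blast+)
  then have "asymptotic_distance x z \<le> asymptotic_radius x"
    using R by simp
  then have "z \<in> asymptotic_center x"
    using asymptotic_radius_le[of x z] by (simp add: mem_asymptotic_center_iff antisym)
  then show ?thesis by blast
qed

lemma asymptotic_center_singleton:
  fixes x :: "nat \<Rightarrow> 'a::hadamard_space"
  assumes "bounded (range x)" "z \<in> asymptotic_center x"
  shows "asymptotic_center x = {z}"
  using asymptotic_center_unique[OF assms(1)] assms(2) by blast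

section \<open>\<open>\<Delta>\<close>-convergent subsequences\<close>

lemma asymptotic_distance_subseq:
  "strict_mono r \<Longrightarrow> asymptotic_distance (x \<circ> r) z \<le> asymptotic_distance x z"
  using limsup_subseq_mono[of r "\<lambda>n. ereal (dist z (x n))"]
  by (simp add: asymptotic_distance_def o_def)

lemma asymptotic_radius_subseq:
  "strict_mono r \<Longrightarrow> asymptotic_radius (x \<circ> r) \<le> asymptotic_radius x"
  unfolding asymptotic_radius_def by (intro INF_mono) (auto intro: asymptotic_distance_subseq)

lemma asymptotic_radius_shift: "asymptotic_radius (x \<circ> (+) k) = asymptotic_radius x"
  using limsup_shift_k[of "\<lambda>n. ereal (dist _ (x n))" k]
  by (simp add: asymptotic_radius_def asymptotic_distance_def o_def add.commute)

lemma bounded_subseq: "bounded (range x) \<Longrightarrow> bounded (range (x \<circ> r))"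
  by (rule bounded_subset) auto

text \<open>Passing to a subsequence can only lower the asymptotic radius. Choosing at stage \<open>n\<close> a
  subsequence whose radius is within \<open>1 / (n + 1)\<close> of the infimum over all further
  subsequences leaves no room for a later drop beyond that amount, and the diagonal sequence
  inherits this bound for every \<open>n\<close>, since the radius depends only on tails.\<close>

lemma regular_subsequence:
  fixes x :: "nat \<Rightarrow> 'a::metric_space"
  assumes bdd: "bounded (range x)"
  obtains d where "strict_mono d"
    "\<And>t. strict_mono t \<Longrightarrow> asymptotic_radius (x \<circ> d \<circ> t) = asymptotic_radius (x \<circ> d)"
proof -
  define P where "P n s \<longleftrightarrow> (\<forall>t. strict_mono t \<longrightarrow>
    asymptotic_radius (x \<circ> s) \<le> asymptotic_radius (x \<circ> s \<circ> t) + ereal (inverse (real (Suc n))))"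
    for n s
  interpret subseqs P
  proof
    fix n and s :: "nat \<Rightarrow> nat" assume s: "strict_mono s"
    let ?e = "ereal (inverse (real (Suc n)))"
    define I where "I = (INF t\<in>{t. strict_mono t}. asymptotic_radius (x \<circ> s \<circ> t))"
    have "I \<le> asymptotic_radius (x \<circ> s \<circ> id)"
      unfolding I_def by (rule INF_lower) (simp add: strict_mono_def)
    moreover have "0 \<le> I"
      unfolding I_def by (rule INF_greatest) (rule asymptotic_radius_nonneg)
    moreover obtain R where "asymptotic_radius (x \<circ> s \<circ> id) = ereal R"
      using asymptotic_radius_real bounded_subseq[OF bounded_subseq[OF bdd]] by metis
    ultimately have "I < I + ?e"
      by (cases I) auto
    then obtain t where t: "strict_mono t" "asymptotic_radius (x \<circ> s \<circ> t) < I + ?e"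
      unfolding I_def INF_less_iff by blast
    have "P n (s \<circ> t)"
      unfolding P_def
    proof (intro allI impI)
      fix t' :: "nat \<Rightarrow> nat" assume "strict_mono t'"
      then have "I \<le> asymptotic_radius (x \<circ> s \<circ> (t \<circ> t'))"
        unfolding I_def using t(1) by (intro INF_lower) (simp add: strict_mono_o)
      then have "I + ?e \<le> asymptotic_radius (x \<circ> s \<circ> (t \<circ> t')) + ?e"
        by (rule add_right_mono)
      then show "asymptotic_radius (x \<circ> (s \<circ> t)) \<le> asymptotic_radius (x \<circ> (s \<circ> t) \<circ> t') + ?e"
        using t(2) by (simp add: o_assoc)
    qed
    then show "\<exists>r'. strict_mono r' \<and> P n (s \<circ> r')"
      using t(1) by blast
  qed
  have stable: "P n (s \<circ> r)" if r: "strict_mono r" and s: "P n s" for n s r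
    unfolding P_def
  proof (intro allI impI)
    fix t :: "nat \<Rightarrow> nat" assume "strict_mono t"
    then have "asymptotic_radius (x \<circ> s)
        \<le> asymptotic_radius (x \<circ> s \<circ> (r \<circ> t)) + ereal (inverse (real (Suc n)))"
      using s r unfolding P_def by (simp add: strict_mono_o)
    then show "asymptotic_radius (x \<circ> (s \<circ> r))
        \<le> asymptotic_radius (x \<circ> (s \<circ> r) \<circ> t) + ereal (inverse (real (Suc n)))"
      using asymptotic_radius_subseq[OF r, of "x \<circ> s"] by (simp add: o_assoc)
  qed
  show ?thesis
  proof
    show "strict_mono diagseq" by (rule subseq_diagseq)
    fix t :: "nat \<Rightarrow> nat" assume t: "strict_mono t"
    have "asymptotic_radius (x \<circ> diagseq)
        \<le> asymptotic_radius (x \<circ> diagseq \<circ> t) + ereal (inverse (real (Suc k)))" for k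
    proof -
      \<comment> \<open>A subsequence of the diagonal sequence, once its first terms are dropped, is a
        subsequence of the tail of the diagonal sequence on which stage \<open>k\<close> holds; \<open>t'\<close>
        reindexes it accordingly.\<close>
      define t' where "t' n = t (Suc k + n) - Suc k" for n
      have ge: "Suc k + n \<le> t (Suc k + n)" for n
        using seq_suble[OF t] .
      have t': "strict_mono t'"
        unfolding strict_mono_def t'_def
      proof (intro allI impI diff_less_mono)
        fix a b :: nat assume "a < b"
        then show "t (Suc k + a) < t (Suc k + b)"
          using t by (simp add: strict_mono_def)
        show "Suc k \<le> t (Suc k + a)"
          using ge[of a] by simp
      qed
      have eq: "diagseq \<circ> (+) (Suc k) \<circ> t' = diagseq \<circ> t \<circ> (+) (Suc k)"
      proof
        fix n
        have "Suc k + (t (Suc k + n) - Suc k) = t (Suc k + n)"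
          using ge[of n] by (intro le_add_diff_inverse) simp
        then show "(diagseq \<circ> (+) (Suc k) \<circ> t') n = (diagseq \<circ> t \<circ> (+) (Suc k)) n"
          unfolding t'_def o_apply by simp
      qed
      have "P k (diagseq \<circ> (+) (Suc k))"
        using diagseq_holds stable by blast
      then have "asymptotic_radius (x \<circ> diagseq \<circ> (+) (Suc k))
        \<le> asymptotic_radius (x \<circ> (diagseq \<circ> (+) (Suc k) \<circ> t')) + ereal (inverse (real (Suc k)))"
        using t' unfolding P_def by (simp add: o_assoc)
      then show ?thesis
        unfolding eq o_assoc asymptotic_radius_shift .
    qed
    moreover have "(\<lambda>k. asymptotic_radius (x \<circ> diagseq \<circ> t) + ereal (inverse (real (Suc k))))
        \<longlonglongrightarrow> asymptotic_radius (x \<circ> diagseq \<circ> t) + ereal 0"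
      by (intro tendsto_add_ereal_general tendsto_const tendsto_ereal LIMSEQ_inverse_real_of_nat) auto
    ultimately have "asymptotic_radius (x \<circ> diagseq) \<le> asymptotic_radius (x \<circ> diagseq \<circ> t) + ereal 0"
      by (intro LIMSEQ_le_const) auto
    then show "asymptotic_radius (x \<circ> diagseq \<circ> t) = asymptotic_radius (x \<circ> diagseq)"
      using asymptotic_radius_subseq[OF t, of "x \<circ> diagseq"] by (simp add: zero_ereal_def[symmetric])
  qed
qed

text \<open>Along a regular subsequence the radius never drops, so the center of the sequence still
  attains the radius of each subsequence and is, by uniqueness, its only center.\<close>

lemma Delta_convergent_subsequence:
  fixes x :: "nat \<Rightarrow> 'a::hadamard_space"
  assumes bdd: "bounded (range x)"
  obtains d z where "strict_mono d" "Delta_convergent_to (x \<circ> d) z"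
proof -
  obtain d where d: "strict_mono d"
    "\<And>t. strict_mono t \<Longrightarrow> asymptotic_radius (x \<circ> d \<circ> t) = asymptotic_radius (x \<circ> d)"
    using regular_subsequence[OF bdd] by blast
  have bd: "bounded (range (x \<circ> d))"
    by (rule bounded_subseq[OF bdd])
  obtain z where z: "z \<in> asymptotic_center (x \<circ> d)"
    using asymptotic_center_nonempty[OF bd] by blast
  have "asymptotic_center (x \<circ> d \<circ> t) = {z}" if t: "strict_mono t" for t
  proof (rule asymptotic_center_singleton)
    show "bounded (range (x \<circ> d \<circ> t))"
      by (rule bounded_subseq[OF bd])
    have "asymptotic_distance (x \<circ> d \<circ> t) z \<le> asymptotic_radius (x \<circ> d \<circ> t)"
      using asymptotic_distance_subseq[OF t, of "x \<circ> d" z] z d(2)[OF t]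
      by (simp add: mem_asymptotic_center_iff)
    then show "z \<in> asymptotic_center (x \<circ> d \<circ> t)"
      using asymptotic_radius_le[of "x \<circ> d \<circ> t" z] by (simp add: mem_asymptotic_center_iff antisym)
  qed
  then show ?thesis
    using that[OF d(1), of z] bd by (simp add: Delta_convergent_to_def)
qed

section \<open>Opial's principle\<close>

lemma asymptotic_distance_perturb_le:
  assumes "(\<lambda>n. dist (x n) (y n)) \<longlonglongrightarrow> 0"
  shows "asymptotic_distance y z \<le> asymptotic_distance x z"
proof -
  have "asymptotic_distance y z \<le> limsup (\<lambda>n. ereal (dist (x n) (y n)) + ereal (dist z (x n)))"
    unfolding asymptotic_distance_def
    by (intro Limsup_mono always_eventually allI) (simp add: add.commute dist_triangle)
  also have "\<dots> = 0 + asymptotic_distance x z"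
    unfolding asymptotic_distance_def
    using assms by (intro ereal_limsup_lim_add) (auto simp: zero_ereal_def)
  finally show ?thesis by simp
qed

lemma asymptotic_center_perturb:
  assumes "(\<lambda>n. dist (x n) (y n)) \<longlonglongrightarrow> 0"
  shows "asymptotic_center y = asymptotic_center x"
proof -
  have "asymptotic_distance y = asymptotic_distance x"
    using asymptotic_distance_perturb_le[of x y] asymptotic_distance_perturb_le[of y x] assms
    by (intro ext antisym) (auto simp: dist_commute)
  then show ?thesis
    by (auto simp: mem_asymptotic_center_iff asymptotic_radius_def)
qed

lemma Delta_convergent_perturb:
  assumes x: "Delta_convergent_to x z" and y: "bounded (range y)"
    and d: "(\<lambda>n. dist (x n) (y n)) \<longlonglongrightarrow> 0"
  shows "Delta_convergent_to y z"
  unfolding Delta_convergent_to_def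
proof (intro conjI allI impI y)
  fix r :: "nat \<Rightarrow> nat" assume r: "strict_mono r"
  have "(\<lambda>n. dist ((x \<circ> r) n) ((y \<circ> r) n)) \<longlonglongrightarrow> 0"
    using LIMSEQ_subseq_LIMSEQ[OF d r] by (simp add: o_def)
  then show "asymptotic_center (y \<circ> r) = {z}"
    using x r asymptotic_center_perturb unfolding Delta_convergent_to_def by blast
qed

lemma asymptotic_distance_limit:
  assumes "(\<lambda>n. dist z (x n)) \<longlonglongrightarrow> L"
  shows "asymptotic_distance x z = ereal L"
  unfolding asymptotic_distance_def
  using assms by (intro lim_imp_Limsup) auto

text \<open>For \<open>q\<close> in \<open>F\<close> the limiting distance \<open>L q\<close> is the asymptotic distance from \<open>q\<close> to any
  subsequence. A \<open>\<Delta>\<close>-limit of one subsequence therefore minimises \<open>L\<close> over \<open>F\<close>, and the least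
  value of \<open>L\<close> is the asymptotic radius of every \<open>\<Delta>\<close>-convergent subsequence. Any subsequence has
  a \<open>\<Delta>\<close>-convergent one inside, so its own radius is at least that value, which the fixed
  minimiser \<open>p\<close> attains.\<close>

lemma Opial_Delta_convergent:
  fixes x :: "nat \<Rightarrow> 'a::hadamard_space"
  assumes ne: "F \<noteq> {}"
    and conv: "\<And>q. q \<in> F \<Longrightarrow> convergent (\<lambda>n. dist q (x n))"
    and cluster: "\<And>r z. strict_mono r \<Longrightarrow> Delta_convergent_to (x \<circ> r) z \<Longrightarrow> z \<in> F"
  shows "\<exists>p\<in>F. Delta_convergent_to x p"
proof -
  obtain q where "q \<in> F" using ne by blast
  then have "bounded (range (\<lambda>n. dist q (x n)))"
    using conv convergent_imp_bounded by (metis convergent_def)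
  then have bdd: "bounded (range x)"
    by (auto simp: bounded_any_center[of _ q] bounded_iff)
  obtain L where L: "\<And>q. q \<in> F \<Longrightarrow> (\<lambda>n. dist q (x n)) \<longlonglongrightarrow> L q"
    using conv unfolding convergent_def by metis
  have L_subseq: "asymptotic_distance (x \<circ> r) q = ereal (L q)" if "strict_mono r" "q \<in> F" for r q
    using LIMSEQ_subseq_LIMSEQ[OF L[OF that(2)] that(1)]
    by (intro asymptotic_distance_limit) (simp add: o_def)
  have minimal: "L z \<le> L q \<and> asymptotic_radius (x \<circ> r) = ereal (L z)"
    if r: "strict_mono r" and z: "Delta_convergent_to (x \<circ> r) z" and q: "q \<in> F" for r z q
  proof -
    have "asymptotic_center (x \<circ> r \<circ> id) = {z}"
      using z unfolding Delta_convergent_to_def by (blast intro: strict_mono_id)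
    then have "asymptotic_distance (x \<circ> r) z = asymptotic_radius (x \<circ> r)"
      using mem_asymptotic_center_iff[of z "x \<circ> r"] by simp
    then show ?thesis
      using asymptotic_radius_le[of "x \<circ> r" q] L_subseq[OF r q] L_subseq[OF r cluster[OF r z]]
      by (metis ereal_less_eq(3))
  qed
  obtain s p where s: "strict_mono s" and p: "Delta_convergent_to (x \<circ> s) p"
    using Delta_convergent_subsequence[OF bdd] .
  have pF: "p \<in> F" using cluster[OF s p] .
  have "asymptotic_center (x \<circ> r) = {p}" if r: "strict_mono r" for r
  proof (rule asymptotic_center_singleton)
    show bdr: "bounded (range (x \<circ> r))" using bounded_subseq[OF bdd] .
    obtain t z where t: "strict_mono t" and z': "Delta_convergent_to (x \<circ> r \<circ> t) z"
      using Delta_convergent_subsequence[OF bdr] .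
    have rt: "strict_mono (r \<circ> t)" using r t by (rule strict_mono_o)
    have z: "Delta_convergent_to (x \<circ> (r \<circ> t)) z" using z' by (simp add: o_assoc)
    have "L z = L p"
      using minimal[OF s p cluster[OF rt z]] minimal[OF rt z pF] by simp
    then have "asymptotic_distance (x \<circ> r) p = asymptotic_radius (x \<circ> r \<circ> t)"
      using L_subseq[OF r pF] minimal[OF rt z pF] by (simp add: o_assoc)
    also have "\<dots> \<le> asymptotic_radius (x \<circ> r)"
      using asymptotic_radius_subseq[OF t] .
    finally show "p \<in> asymptotic_center (x \<circ> r)"
      using asymptotic_radius_le[of "x \<circ> r" p] by (simp add: mem_asymptotic_center_iff antisym)
  qed
  then show ?thesis
    using pF bdd unfolding Delta_convergent_to_def by blast
qed

section \<open>Iterating a composition of strongly quasi-nonexpansive maps\<close>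

lemma composition_dist_decreasing:
  assumes "\<And>i. i \<in> {1..m} \<Longrightarrow> quasi_nonexpansive (S i)"
    and "q \<in> (\<Inter>i\<in>{1..m}. Fix (S i))" and "j \<le> k" "k \<le> m"
  shows "dist (composition S k w) q \<le> dist (composition S j w) q"
  using assms(3,4)
proof (induction k rule: dec_induct)
  case (step k)
  have "dist (S (Suc k) (composition S k w)) q \<le> dist (composition S k w) q"
    using assms(1)[of "Suc k"] assms(2) step by (auto simp: quasi_nonexpansive_def)
  then show ?case using step by simp
qed simp

theorem corollary1:
  fixes S :: "nat \<Rightarrow> 'a::hadamard_space \<Rightarrow> 'a" and m :: nat and p0 :: 'a and x :: "nat \<Rightarrow> 'a"
  assumes "m \<ge> 1"
    and "\<And>i. i \<in> {1..m} \<Longrightarrow> strongly_quasi_nonexpansive (S i)"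
    and "\<And>i. i \<in> {1..m} \<Longrightarrow> Delta_demiclosed (S i)"
    and "(\<Inter>i\<in>{1..m}. Fix (S i)) \<noteq> {}"
    and "\<And>n. x n = (composition S m ^^ n) p0"
  shows "\<exists>p \<in> (\<Inter>i\<in>{1..m}. Fix (S i)). Delta_convergent_to x p"
proof (rule Opial_Delta_convergent[OF assms(4)])
  let ?F = "\<Inter>i\<in>{1..m}. Fix (S i)"
  define y where "y j n = composition S j (x n)" for j n
  have y0: "y 0 = x" and yS: "y (Suc j) n = S (Suc j) (y j n)" for j n
    by (auto simp: y_def)
  have ym: "y m n = x (Suc n)" for n
    by (simp add: y_def assms(5))
  have qne: "quasi_nonexpansive (S i)" if "i \<in> {1..m}" for i
    using assms(2)[OF that] by (simp add: strongly_quasi_nonexpansive_def)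
  have decr: "dist (y k n) q \<le> dist (y j n) q" if "q \<in> ?F" "j \<le> k" "k \<le> m" for q j k n
    unfolding y_def using composition_dist_decreasing[OF qne that] .
  have conv: "convergent (\<lambda>n. dist (x n) q)" if "q \<in> ?F" for q
  proof (rule decseq_convergent[of _ 0])
    show "decseq (\<lambda>n. dist (x n) q)"
      using decr[OF that, of 0 m] by (auto simp: decseq_Suc_iff y0 ym)
  qed (auto simp: convergent_def)
  then show "convergent (\<lambda>n. dist q (x n))" if "q \<in> ?F" for q
    using that by (simp add: dist_commute)
  obtain q where q: "q \<in> ?F" using assms(4) by blast
  obtain L where L: "(\<lambda>n. dist (x n) q) \<longlonglongrightarrow> L"
    using conv[OF q] by (auto simp: convergent_def)
  \<comment> \<open>The distance of \<open>y j n\<close> to \<open>q\<close> lies between two consecutive terms of \<open>dist (x n) q\<close>.\<close>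
  have yL: "(\<lambda>n. dist (y j n) q) \<longlonglongrightarrow> L" if "j \<le> m" for j
  proof (rule tendsto_sandwich)
    show "\<forall>\<^sub>F n in sequentially. dist (x (Suc n)) q \<le> dist (y j n) q"
      using decr[OF q that order_refl] by (simp add: ym)
    show "\<forall>\<^sub>F n in sequentially. dist (y j n) q \<le> dist (x n) q"
      using decr[OF q _ that, of 0] by (simp add: y0)
    show "(\<lambda>n. dist (x (Suc n)) q) \<longlonglongrightarrow> L"
      using L by (rule LIMSEQ_Suc)
  qed (rule L)
  have bdd: "bounded (range (y j))" if "j \<le> m" for j
  proof -
    have "bounded (range (\<lambda>n. dist (y j n) q))"
      using yL[OF that] by (rule convergent_imp_bounded)
    then show ?thesis
      by (auto simp: bounded_any_center[of _ q] bounded_iff dist_commute)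
  qed
  have step: "(\<lambda>n. dist (y j n) (S (Suc j) (y j n))) \<longlonglongrightarrow> 0" if "Suc j \<le> m" for j
  proof -
    have "(\<lambda>n. dist (y j n) q - dist (S (Suc j) (y j n)) q) \<longlonglongrightarrow> L - L"
      using yL[of j] yL[of "Suc j"] that by (intro tendsto_diff) (auto simp: yS)
    moreover have "strongly_quasi_nonexpansive (S (Suc j))" "q \<in> Fix (S (Suc j))"
      using assms(2) q that by auto
    ultimately show ?thesis
      using bdd[of j] that unfolding strongly_quasi_nonexpansive_def by force
  qed
  have near: "(\<lambda>n. dist (x n) (y j n)) \<longlonglongrightarrow> 0" if "j \<le> m" for j
    using that
  proof (induction j)
    case (Suc j)
    then have "(\<lambda>n. dist (x n) (y j n) + dist (y j n) (y (Suc j) n)) \<longlonglongrightarrow> 0 + 0"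
      using step[of j] by (intro tendsto_add) (auto simp: yS)
    then have "(\<lambda>n. dist (x n) (y j n) + dist (y j n) (y (Suc j) n)) \<longlonglongrightarrow> 0"
      by simp
    then show ?case
      by (rule Lim_null_comparison[rotated]) (simp add: dist_triangle)
  qed (simp add: y0)
  fix r z assume r: "strict_mono (r :: nat \<Rightarrow> nat)" and z: "Delta_convergent_to (x \<circ> r) z"
  show "z \<in> ?F"
  proof
    fix i assume i: "i \<in> {1..m}"
    then obtain j where j: "i = Suc j" "Suc j \<le> m"
      by (cases i) auto
    have "Delta_convergent_to (y j \<circ> r) z"
      using LIMSEQ_subseq_LIMSEQ[OF near[of j] r] j
      by (intro Delta_convergent_perturb[OF z] bounded_subseq bdd) (auto simp: o_def)
    moreover have "(\<lambda>n. dist ((y j \<circ> r) n) (S i ((y j \<circ> r) n))) \<longlonglongrightarrow> 0"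
      using LIMSEQ_subseq_LIMSEQ[OF step[OF j(2)] r] by (simp add: o_def j(1))
    ultimately show "z \<in> Fix (S i)"
      using assms(3)[OF i] unfolding Delta_demiclosed_def by blast
  qed
qed

end
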